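(* Let $X$ be a zero-dimensional Hausdorff space and let $F$ be a totally ordered field. Then $$C^c_K(X,F)=\bigcap\{O^{p,F}_c: p\in\beta_0X\setminus X\}.$$
   Context: A totally ordered field $F$ carries its order (interval) topology. $C_c(X,F)$ is the ring of all continuous functions $f:X\to F$ whose range $f(X)$ is countable, and $Z_c(f)=\{x\in X: f(x)=0\}$. $C^c_K(X,F)=\{f\in C_c(X,F): \mathrm{cl}_X(X\setminus Z_c(f))\text{ is compact}\}$. A space is zero-dimensional if it has a base of clopen sets. The Banaschewski compactification $\beta_0X$ of a Hausdorff zero-dimensional space $X$ is the (unique up to equivalence) zero-dimensional Hausdorff compactification of $X$ such that every continuous map from $X$ to a compact Hausdorff zero-dimensional space $Y$ extends to a continuous map $\beta_0X\to Y$; $X$ is regarded as a dense subspace of $\beta_0X$. For $p\in\beta_0X$, $O^{p,F}_c=\{f\in C_c(X,F): \mathrm{cl}_{\beta_0X}Z_c(f)\text{ is a neighbourhood of } p\text{ in }\beta_0X\}$. An intersection over an empty index set is taken to be all of $C_c(X,F)$. *)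

theory Defs
  imports "HOL-Analysis.Analysis"
begin

definition zero_dimensional_space :: "'a topology \<Rightarrow> bool" where
  "zero_dimensional_space X \<longleftrightarrow>
     (\<exists>\<B>. (\<forall>V\<in>\<B>. openin X V \<and> closedin X V) \<and> openin X = arbitrary union_of (\<lambda>V. V \<in> \<B>))"

text \<open>A totally ordered field with its order topology is a type of sort
  \<open>{linordered_field, linorder_topology}\<close>. Since HOL functions are total, the elements of
  \<open>countable_range_fun X\<close>, \<open>C\<^sub>c(X,F)\<close>, are made to be \<open>undefined\<close> off \<open>topspace X\<close>, so that they
  correspond bijectively to functions on the space itself.\<close>

definition countable_range_fun ::
  "'a topology \<Rightarrow> ('a \<Rightarrow> 'f::{linordered_field, linorder_topology}) set" where
  "countable_range_fun X =
     {f \<in> extensional (topspace X). continuous_map X euclidean f \<and> countable (f ` topspace X)}"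

definition zero_set :: "'a topology \<Rightarrow> ('a \<Rightarrow> 'f::zero) \<Rightarrow> 'a set" where
  "zero_set X f = {x \<in> topspace X. f x = 0}"

definition countable_range_fun_compact_support ::
  "'a topology \<Rightarrow> ('a \<Rightarrow> 'f::{linordered_field, linorder_topology}) set" where
  "countable_range_fun_compact_support X =
     {f \<in> countable_range_fun X. compactin X (X closure_of (topspace X - zero_set X f))}"

text \<open>\<open>B\<close> is the Banaschewski compactification of \<open>X\<close>, with \<open>X\<close> identified with its image under
  the dense embedding \<open>e\<close>. The universal property speaks of targets of arbitrary size, which HOL
  cannot quantify over. Letting \<open>Y\<close> range over topologies on \<open>'a set set\<close> loses nothing: the
  closure in \<open>Y\<close> of the image of \<open>X\<close> has at most as many points as that type, and is again compact,
  Hausdorff and zero-dimensional. The lemma \<open>banaschewski_extension\<close> below gives the property for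
  targets on every type.\<close>

definition banaschewski_compactification ::
  "'a topology \<Rightarrow> 'b topology \<Rightarrow> ('a \<Rightarrow> 'b) \<Rightarrow> bool" where
  "banaschewski_compactification X B e \<longleftrightarrow>
     compact_space B \<and> Hausdorff_space B \<and> zero_dimensional_space B \<and>
     embedding_map X B e \<and> B closure_of (e ` topspace X) = topspace B \<and>
     (\<forall>(Y :: 'a set set topology) f.
        compact_space Y \<and> Hausdorff_space Y \<and> zero_dimensional_space Y \<and> continuous_map X Y f \<longrightarrow>
        (\<exists>g. continuous_map B Y g \<and> (\<forall>x\<in>topspace X. g (e x) = f x)))"

text \<open>\<open>banaschewski_O X B e p\<close> is \<open>O\<^sub>c\<close> at the point \<open>p\<close> of \<open>B\<close>: closures and neighbourhoods are
  those of \<open>B\<close>.\<close>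

definition banaschewski_O ::
  "'a topology \<Rightarrow> 'b topology \<Rightarrow> ('a \<Rightarrow> 'b) \<Rightarrow> 'b \<Rightarrow>
     ('a \<Rightarrow> 'f::{linordered_field, linorder_topology}) set" where
  "banaschewski_O X B e p =
     {f \<in> countable_range_fun X. \<exists>U. openin B U \<and> p \<in> U \<and> U \<subseteq> B closure_of (e ` zero_set X f)}"

lemma zero_dimensional_space_iff:
  "zero_dimensional_space X \<longleftrightarrow>
     (\<forall>U x. openin X U \<and> x \<in> U \<longrightarrow> (\<exists>V. openin X V \<and> closedin X V \<and> x \<in> V \<and> V \<subseteq> U))"
  (is "_ \<longleftrightarrow> ?R")
proof
  assume "zero_dimensional_space X"
  then obtain \<B> where "\<forall>V\<in>\<B>. openin X V \<and> closedin X V"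
    and "\<forall>U x. openin X U \<and> x \<in> U \<longrightarrow> (\<exists>V. V \<in> \<B> \<and> x \<in> V \<and> V \<subseteq> U)"
    unfolding zero_dimensional_space_def openin_topology_base_unique by blast
  then show ?R
    by meson
next
  assume R: ?R
  show "zero_dimensional_space X"
    unfolding zero_dimensional_space_def openin_topology_base_unique
    by (rule exI[of _ "{V. openin X V \<and> closedin X V}"]) (use R in auto)
qed

lemma zero_dimensional_space_subtopology:
  assumes "zero_dimensional_space X"
  shows "zero_dimensional_space (subtopology X S)"
  unfolding zero_dimensional_space_iff
proof (intro allI impI)
  fix U x assume "openin (subtopology X S) U \<and> x \<in> U"
  then obtain T where T: "openin X T" "U = T \<inter> S" "x \<in> T" "x \<in> S"
    by (auto simp: openin_subtopology)
  then obtain V where "openin X V" "closedin X V" "x \<in> V" "V \<subseteq> T"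
    using assms unfolding zero_dimensional_space_iff by meson
  then have "openin (subtopology X S) (V \<inter> S)" "closedin (subtopology X S) (V \<inter> S)"
    "x \<in> V \<inter> S" "V \<inter> S \<subseteq> U"
    using T unfolding openin_subtopology closedin_subtopology by blast+
  then show "\<exists>V. openin (subtopology X S) V \<and> closedin (subtopology X S) V \<and> x \<in> V \<and> V \<subseteq> U"
    by blast
qed

lemma zero_dimensional_space_homeomorphic_map:
  assumes h: "homeomorphic_map X Y h" and "zero_dimensional_space X"
  shows "zero_dimensional_space Y"
  unfolding zero_dimensional_space_iff
proof (intro allI impI)
  fix U y assume U: "openin Y U \<and> y \<in> U"
  define T where "T = {x \<in> topspace X. h x \<in> U}"
  have "openin X T"
    using U h unfolding T_def
    by (auto simp: homeomorphic_eq_everything_map continuous_map_def)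
  have "y \<in> topspace Y"
    using U openin_subset by blast
  then obtain x where x: "x \<in> topspace X" "h x = y"
    using h by (metis homeomorphic_imp_surjective_map image_iff)
  then obtain V where V: "openin X V" "closedin X V" "x \<in> V" "V \<subseteq> T"
    using assms(2) \<open>openin X T\<close> U T_def unfolding zero_dimensional_space_iff
    by (metis (mono_tags, lifting) mem_Collect_eq)
  then have "openin Y (h ` V)" "closedin Y (h ` V)"
    using h by (simp_all add: homeomorphic_map_openness homeomorphic_map_closedness openin_subset)
  with V x show "\<exists>V. openin Y V \<and> closedin Y V \<and> y \<in> V \<and> V \<subseteq> U"
    by (intro exI[of _ "h ` V"]) (auto simp: T_def)
qed

lemma banaschewski_extension:
  fixes X :: "'a topology" and B :: "'b topology" and Y :: "'c topology"
  assumes B: "banaschewski_compactification X B e"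
    and Y: "compact_space Y" "Hausdorff_space Y" "zero_dimensional_space Y"
    and f: "continuous_map X Y f"
  shows "\<exists>g. continuous_map B Y g \<and> (\<forall>x\<in>topspace X. g (e x) = f x)"
proof -
  define K where "K = Y closure_of (f ` topspace X)"
  define j where "j y = {S. S \<subseteq> topspace X \<and> y \<in> Y closure_of (f ` S)}" for y
  have fim: "f ` topspace X \<subseteq> topspace Y"
    using f continuous_map_image_subset_topspace by blast
  then have fK: "f ` topspace X \<subseteq> K"
    by (simp add: K_def closure_of_subset)
  have KY: "K \<subseteq> topspace Y"
    by (simp add: K_def closure_of_subset_topspace)
  have inj: "inj_on j K"
  proof (rule inj_onI, rule ccontr)
    fix y z assume yz: "y \<in> K" "z \<in> K" "j y = j z" "y \<noteq> z"
    then obtain U V where UV: "openin Y U" "openin Y V" "y \<in> U" "z \<in> V" "disjnt U V"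
      using Y(2) KY unfolding Hausdorff_space_def by (meson subsetD)
    define S where "S = {x \<in> topspace X. f x \<in> U}"
    have "y \<in> Y closure_of (f ` S)"
      unfolding in_closure_of
    proof (intro conjI allI impI)
      show "y \<in> topspace Y" using yz KY by auto
      fix T assume T: "y \<in> T \<and> openin Y T"
      then have "openin Y (T \<inter> U)" "y \<in> T \<inter> U"
        using UV by auto
      then obtain w where "w \<in> f ` topspace X" "w \<in> T \<inter> U"
        using yz(1) unfolding K_def in_closure_of by meson
      then show "\<exists>w. w \<in> f ` S \<and> w \<in> T"
        by (auto simp: S_def)
    qed
    then have "S \<in> j y" by (auto simp: j_def S_def)
    then have "z \<in> Y closure_of (f ` S)" using yz by (auto simp: j_def)
    then obtain w where "w \<in> f ` S" "w \<in> V"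
      using UV unfolding in_closure_of by meson
    then show False using UV by (auto simp: S_def disjnt_iff)
  qed
  define i where "i = inv_into K j"
  have ij: "i (j y) = y" if "y \<in> K" for y
    using that inj by (simp add: i_def)
  define Y' where "Y' = pullback_topology (j ` K) i (subtopology Y K)"
  have tY': "topspace Y' = j ` K"
    using KY ij by (auto simp: Y'_def topspace_pullback_topology)
  have hm: "homeomorphic_maps (subtopology Y K) Y' j i"
    unfolding homeomorphic_maps_def
  proof (intro conjI ballI)
    show "continuous_map (subtopology Y K) Y' j"
      unfolding continuous_map_def
    proof (intro conjI allI impI)
      show "j \<in> topspace (subtopology Y K) \<rightarrow> topspace Y'"
        by (auto simp: tY')
      fix U assume "openin Y' U"
      then obtain V where V: "openin (subtopology Y K) V" "U = i -` V \<inter> j ` K"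
        unfolding Y'_def openin_pullback_topology by blast
      then have "V \<subseteq> topspace Y \<inter> K"
        using openin_subset by fastforce
      then have "{x \<in> topspace (subtopology Y K). j x \<in> U} = V"
        using V ij by auto
      then show "openin (subtopology Y K) {x \<in> topspace (subtopology Y K). j x \<in> U}"
        using V by simp
    qed
    have "continuous_map Y' (subtopology Y K) (id \<circ> i)"
      unfolding Y'_def by (rule continuous_map_pullback) simp
    then show "continuous_map Y' (subtopology Y K) i" by simp
  qed (use ij tY' in auto)
  have hj: "homeomorphic_map (subtopology Y K) Y' j"
    using hm homeomorphic_map_maps by metis
  have hs: "subtopology Y K homeomorphic_space Y'"
    using hm unfolding homeomorphic_space_def by metis
  have ci: "continuous_map Y' (subtopology Y K) i" and cj: "continuous_map (subtopology Y K) Y' j"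
    using hm unfolding homeomorphic_maps_def by simp_all
  have "compact_space (subtopology Y K)"
    using Y(1) by (simp add: K_def closedin_compact_space compact_space_subtopology)
  then have "compact_space Y'"
    using hs homeomorphic_compact_space by metis
  moreover have "Hausdorff_space Y'"
    using homeomorphic_Hausdorff_space[OF hs] Hausdorff_space_subtopology[OF Y(2)] by simp
  moreover have "zero_dimensional_space Y'"
    by (rule zero_dimensional_space_homeomorphic_map[OF hj zero_dimensional_space_subtopology[OF Y(3)]])
  moreover have "continuous_map X Y' (j \<circ> f)"
    using f fK cj by (intro continuous_map_compose[of _ "subtopology Y K"])
      (auto simp: continuous_map_in_subtopology)
  ultimately obtain g where g: "continuous_map B Y' g" "\<forall>x\<in>topspace X. g (e x) = (j \<circ> f) x"
    using B unfolding banaschewski_compactification_def by blast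
  have "continuous_map B Y (i \<circ> g)"
    using continuous_map_compose[OF g(1) ci] continuous_map_into_fulltopology by blast
  moreover have "(i \<circ> g) (e x) = f x" if "x \<in> topspace X" for x
    using that g(2) ij fK by auto
  ultimately show ?thesis by blast
qed

end

theory Submission
  imports Defs
begin

text \<open>Both sides of the equation say where the cozero set \<open>C = X - Z(f)\<close> accumulates in \<open>B\<close>.

  A subset of \<open>X\<close> has compact closure in \<open>X\<close> exactly if its closure in the compact Hausdorff
  space \<open>B\<close> acquires no point outside \<open>X\<close> (\<open>compactin_closure_of_embedding_iff\<close>), so \<open>f\<close> has
  compact support iff no point of \<open>B - X\<close> lies in the closure of \<open>C\<close>. On the other hand, \<open>C\<close> and
  \<open>Z(f)\<close> cover a dense subset of \<open>B\<close>, and \<open>Z(f)\<close> is closed in \<open>X\<close>; hence the closure of \<open>Z(f)\<close>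
  is a neighbourhood of \<open>p\<close> iff \<open>p\<close> is not in the closure of \<open>C\<close>, for every point \<open>p\<close> of \<open>B\<close>
  (\<open>banaschewski_O_iff\<close>). Ranging over \<open>p \<in> B - X\<close> makes the two conditions the same.\<close>

lemma embedding_map_closure_of:
  assumes "embedding_map X B e" and "S \<subseteq> topspace X"
  shows "e ` (X closure_of S) = e ` topspace X \<inter> B closure_of (e ` S)"
proof -
  have "e ` (X closure_of S) = subtopology B (e ` topspace X) closure_of (e ` S)"
    using assms homeomorphic_map_closure_of unfolding embedding_map_def by metis
  also have "\<dots> = e ` topspace X \<inter> B closure_of (e ` S)"
    using image_mono[OF assms(2), of e] by (simp add: closure_of_subtopology Int_absorb1)
  finally show ?thesis .
qed

lemma embedding_map_compactin_iff:
  assumes "embedding_map X B e" and "K \<subseteq> topspace X"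
  shows "compactin X K \<longleftrightarrow> compactin B (e ` K)"
proof -
  have "compactin X K \<longleftrightarrow> compactin (subtopology B (e ` topspace X)) (e ` K)"
    using assms homeomorphic_map_compactness unfolding embedding_map_def by metis
  then show ?thesis
    using assms(2) by (auto simp: compactin_subtopology)
qed

text \<open>A compact closure in \<open>X\<close> is closed in \<open>B\<close>, so it already contains the closure in \<open>B\<close>;
  conversely, a closure in \<open>B\<close> that stays in \<open>X\<close> is a compact set and is the closure in \<open>X\<close>.\<close>

lemma compactin_closure_of_embedding_iff:
  assumes e: "embedding_map X B e" and B: "compact_space B" "Hausdorff_space B"
    and S: "S \<subseteq> topspace X"
  shows "compactin X (X closure_of S) \<longleftrightarrow> B closure_of (e ` S) \<subseteq> e ` topspace X"
proof -
  have cl: "e ` (X closure_of S) = e ` topspace X \<inter> B closure_of (e ` S)"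
    by (rule embedding_map_closure_of[OF e S])
  have comp: "compactin X (X closure_of S) \<longleftrightarrow> compactin B (e ` (X closure_of S))"
    by (rule embedding_map_compactin_iff[OF e closure_of_subset_topspace])
  show ?thesis
  proof
    assume "compactin X (X closure_of S)"
    then have "closedin B (e ` (X closure_of S))"
      using B(2) comp compactin_imp_closedin by blast
    moreover have "e ` S \<subseteq> e ` (X closure_of S)"
      using S by (intro image_mono closure_of_subset)
    ultimately have "B closure_of (e ` S) \<subseteq> e ` (X closure_of S)"
      by (intro closure_of_minimal)
    then show "B closure_of (e ` S) \<subseteq> e ` topspace X"
      using cl by blast
  next
    assume "B closure_of (e ` S) \<subseteq> e ` topspace X"
    then have "e ` (X closure_of S) = B closure_of (e ` S)"
      using cl by blast
    then show "compactin X (X closure_of S)"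
      using B(1) comp by (simp add: closedin_compact_space)
  qed
qed

lemma closedin_zero_set:
  fixes f :: "'a \<Rightarrow> 'f::{t1_space, zero}"
  assumes "continuous_map X euclidean f"
  shows "closedin X (zero_set X f)"
  using closedin_continuous_map_preimage[OF assms, of "{0}"] by (simp add: zero_set_def)

text \<open>If the closure of the zero set contains an open neighbourhood of \<open>p\<close>, then that neighbourhood
  misses the cozero set, since within \<open>X\<close> the closure adds nothing to the zero set. If \<open>p\<close> is not
  in the closure of the cozero set, then the complement of that closure is the neighbourhood wanted,
  by density.\<close>

lemma banaschewski_O_iff:
  fixes f :: "'a \<Rightarrow> 'f::{linordered_field, linorder_topology}"
  assumes e: "embedding_map X B e" and dense: "B closure_of (e ` topspace X) = topspace B"
    and f: "f \<in> countable_range_fun X" and p: "p \<in> topspace B"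
  shows "f \<in> banaschewski_O X B e p \<longleftrightarrow> p \<notin> B closure_of (e ` (topspace X - zero_set X f))"
proof -
  let ?Z = "zero_set X f" and ?C = "topspace X - zero_set X f"
  have Z: "?Z \<subseteq> topspace X"
    by (auto simp: zero_set_def)
  show ?thesis
  proof
    assume "f \<in> banaschewski_O X B e p"
    then obtain U where U: "openin B U" "p \<in> U" "U \<subseteq> B closure_of (e ` ?Z)"
      unfolding banaschewski_O_def by blast
    have "closedin X ?Z"
      using f by (intro closedin_zero_set) (simp add: countable_range_fun_def)
    then have "e ` topspace X \<inter> B closure_of (e ` ?Z) = e ` ?Z"
      using embedding_map_closure_of[OF e Z] by (simp add: closure_of_closedin)
    moreover have "e ` ?Z \<inter> e ` ?C = {}"
      using e Z unfolding embedding_map_def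
      by (auto simp: homeomorphic_eq_everything_map inj_on_def)
    ultimately have "U \<inter> e ` ?C = {}"
      using U(3) by blast
    then show "p \<notin> B closure_of (e ` ?C)"
      using U(1,2) unfolding in_closure_of by blast
  next
    assume "p \<notin> B closure_of (e ` ?C)"
    moreover have "openin B (topspace B - B closure_of (e ` ?C))"
      by (simp add: openin_diff)
    moreover have "topspace B = B closure_of (e ` ?Z) \<union> B closure_of (e ` ?C)"
    proof -
      have "e ` topspace X = e ` ?Z \<union> e ` ?C"
        using Z by blast
      then show ?thesis
        using dense by (metis closure_of_Un)
    qed
    ultimately show "f \<in> banaschewski_O X B e p"
      using f p unfolding banaschewski_O_def by blast
  qed
qed

theorem theorem3p5:
  fixes X :: "'a topology" and B :: "'b topology" and e :: "'a \<Rightarrow> 'b"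
  assumes "Hausdorff_space X" and "zero_dimensional_space X"
    and "banaschewski_compactification X B e"
  shows "(countable_range_fun_compact_support X
            :: ('a \<Rightarrow> 'f::{linordered_field, linorder_topology}) set) =
         countable_range_fun X \<inter> (\<Inter>p \<in> topspace B - e ` topspace X. banaschewski_O X B e p)"
proof -
  have B: "compact_space B" "Hausdorff_space B" and e: "embedding_map X B e"
    and dense: "B closure_of (e ` topspace X) = topspace B"
    using assms(3) unfolding banaschewski_compactification_def by blast+
  have "compactin X (X closure_of (topspace X - zero_set X f)) \<longleftrightarrow>
      (\<forall>p \<in> topspace B - e ` topspace X. f \<in> banaschewski_O X B e p)"
    if f: "f \<in> countable_range_fun X" for f :: "'a \<Rightarrow> 'f"
  proof -
    let ?C = "topspace X - zero_set X f"
    have "compactin X (X closure_of ?C) \<longleftrightarrow> B closure_of (e ` ?C) \<subseteq> e ` topspace X"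
      by (rule compactin_closure_of_embedding_iff[OF e B Diff_subset])
    also have "\<dots> \<longleftrightarrow> (\<forall>p \<in> topspace B - e ` topspace X. p \<notin> B closure_of (e ` ?C))"
      using closure_of_subset_topspace[of B "e ` ?C"] by blast
    also have "\<dots> \<longleftrightarrow> (\<forall>p \<in> topspace B - e ` topspace X. f \<in> banaschewski_O X B e p)"
      using banaschewski_O_iff[OF e dense f] by blast
    finally show ?thesis .
  qed
  then show ?thesis
    unfolding countable_range_fun_compact_support_def by blast
qed

end
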